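(* For every $\sigma\in S(g)^{open}$, $\operatorname{rank}T(\tilde\sigma)=\dim_{\mathbb F_p}(\mathbb F_{p^2}W_\sigma)-g$.
   Context: Let $p$ be an odd prime and $K=\mathbb Q(\sqrt{-\Delta})$ ($\Delta>0$ a squarefree integer) an imaginary quadratic field in which $p$ is inert; $\mathbb F_{p^2}=O_K/p=\mathbb F_p[\sqrt{-\Delta}]$. Let $g=\mathfrak r+\mathfrak s$ and $E=E_{\mathfrak r\mathfrak s}=\mathrm{diag}(1_{\mathfrak r},-1_{\mathfrak s})$. $S(g)^{open}$ is the set of matrices $\sigma=\sigma(s)=\begin{pmatrix}1_g& s\\0&p1_g\end{pmatrix}$ where $s\in M_g(\mathbb Z)$ is symmetric with entries in a fixed system of residues modulo $p$. Put $T(\sigma)=E+\Delta sEs$, and let $T(\tilde\sigma)\in M_g(\mathbb F_p)$ be its reduction modulo $p$; tilde denotes reduction modulo $p$. Let $\mathbb F_{p^2}$ act on row vectors $(x,y)\in\mathbb F_p^g\times\mathbb F_p^g$ by $\sqrt{-\Delta}\cdot(x,y)=(-\Delta yE,xE)$, and let $W_\sigma\subset\mathbb F_p^{2g}$ be the row space of the $g\times 2g$ matrix $(1_g,\tilde s)$. (This is the isotropic subspace attached to $\sigma$ in the $p$-torsion $(A_t)_p\cong\mathbb F_p^{2g}$ of an abelian $g$-fold $A_t$ with multiplication by $O_K$.) *)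

theory Defs
  imports
    Complex_Main
    "HOL-Algebra.Ideal"
    "HOL-Computational_Algebra.Polynomial"
    "HOL-Computational_Algebra.Squarefree"
    "HOL-Number_Theory.Cong"
    "Jordan_Normal_Form.DL_Rank"
    "Berlekamp_Zassenhaus.Finite_Field"
begin

definition sqrt_neg :: "int \<Rightarrow> complex" where
  "sqrt_neg \<Delta> = \<i> * of_real (sqrt (of_int \<Delta>))"

definition imag_quad_field :: "int \<Rightarrow> complex set" where
  "imag_quad_field \<Delta> = {of_rat a + of_rat b * sqrt_neg \<Delta> | a b. True}"

definition ring_of_integers :: "int \<Rightarrow> complex ring" where
  "ring_of_integers \<Delta> = class_ring\<lparr>carrier := {z \<in> imag_quad_field \<Delta>. algebraic_int z}\<rparr>"

text \<open>In a quadratic field, a rational prime p is inert iff the ideal of the ring of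
  integers generated by p is prime: the other possibilities are a product of two distinct
  primes or the square of a prime.\<close>

definition inert :: "nat \<Rightarrow> int \<Rightarrow> bool" where
  "inert p \<Delta> \<longleftrightarrow>
     primeideal (PIdl\<^bsub>ring_of_integers \<Delta>\<^esub> of_nat p) (ring_of_integers \<Delta>)"

text \<open>A complete system of representatives modulo p.\<close>

definition residue_system :: "nat \<Rightarrow> int set \<Rightarrow> bool" where
  "residue_system p R \<longleftrightarrow> (\<forall>x. \<exists>!a. a \<in> R \<and> [a = x] (mod int p))"

definition E_mat :: "nat \<Rightarrow> nat \<Rightarrow> 'a::ring_1 mat" where
  "E_mat r s = four_block_mat (1\<^sub>m r) (0\<^sub>m r s) (0\<^sub>m s r) (- 1\<^sub>m s)"

definition S_open :: "nat \<Rightarrow> int set \<Rightarrow> nat \<Rightarrow> int mat set" where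
  "S_open p R g =
     {four_block_mat (1\<^sub>m g) S (0\<^sub>m g g) (of_nat p \<cdot>\<^sub>m 1\<^sub>m g) | S.
        S \<in> carrier_mat g g \<and> transpose_mat S = S \<and> elements_mat S \<subseteq> R}"

definition upper_right :: "nat \<Rightarrow> 'a mat \<Rightarrow> 'a mat" where
  "upper_right g \<sigma> = (case split_block \<sigma> g g of (A, B, C, D) \<Rightarrow> B)"

definition T_mat :: "nat \<Rightarrow> nat \<Rightarrow> int \<Rightarrow> int mat \<Rightarrow> int mat" where
  "T_mat r s \<Delta> \<sigma> =
     (let S = upper_right (r + s) \<sigma> in E_mat r s + \<Delta> \<cdot>\<^sub>m (S * E_mat r s * S))"

text \<open>The prime p is the cardinality of the type variable \<open>'p\<close>, so that \<open>'p mod_ring\<close> is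
  the field with p elements.\<close>

abbreviation reduce :: "int mat \<Rightarrow> 'p::prime_card mod_ring mat" where
  "reduce A \<equiv> map_mat of_int A"

text \<open>The field with \<open>p\<^sup>2\<close> elements, obtained by adjoining \<open>\<surd>-\<Delta>\<close> to the field with p
  elements; the pair \<open>(a, b)\<close> stands for \<open>a + b \<surd>-\<Delta>\<close>.\<close>

definition Fp2 :: "int \<Rightarrow> ('p::prime_card mod_ring \<times> 'p mod_ring) ring" where
  "Fp2 \<Delta> = \<lparr>carrier = UNIV,
     mult = (\<lambda>(a, b) (c, d). (a * c - of_int \<Delta> * b * d, a * d + b * c)),
     one = (1, 0),
     zero = (0, 0),
     add = (\<lambda>(a, b) (c, d). (a + c, b + d))\<rparr>"

text \<open>Vectors carry no row or column orientation; the row vector \<open>yE\<close> is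
  \<open>transpose_mat E *\<^sub>v y\<close>.\<close>

definition sqrt_act :: "nat \<Rightarrow> nat \<Rightarrow> int \<Rightarrow> 'p::prime_card mod_ring vec \<Rightarrow> 'p mod_ring vec" where
  "sqrt_act r s \<Delta> v =
     (let x = vec_first v (r + s); y = vec_last v (r + s) in
      (- of_int \<Delta> \<cdot>\<^sub>v (transpose_mat (E_mat r s) *\<^sub>v y)) @\<^sub>v (transpose_mat (E_mat r s) *\<^sub>v x))"

definition Fp2_module ::
  "nat \<Rightarrow> nat \<Rightarrow> int \<Rightarrow> ('p::prime_card mod_ring \<times> 'p mod_ring, 'p mod_ring vec) module" where
  "Fp2_module r s \<Delta> = \<lparr>carrier = carrier_vec (2 * (r + s)),
     mult = undefined,
     one = undefined,
     zero = 0\<^sub>v (2 * (r + s)),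
     add = (+),
     module.smult = (\<lambda>(a, b) v. a \<cdot>\<^sub>v v + b \<cdot>\<^sub>v sqrt_act r s \<Delta> v)\<rparr>"

text \<open>The block matrix with empty lower blocks is the \<open>g \<times> 2g\<close> matrix \<open>(1, S)\<close>.\<close>

definition W_space :: "nat \<Rightarrow> int mat \<Rightarrow> 'p::prime_card mod_ring vec set" where
  "W_space g \<sigma> = vec_space.row_space (2 * g)
     (four_block_mat (1\<^sub>m g) (reduce (upper_right g \<sigma>)) (0\<^sub>m 0 g) (0\<^sub>m 0 g))"

definition Fp2_span ::
  "nat \<Rightarrow> nat \<Rightarrow> int \<Rightarrow> 'p::prime_card mod_ring vec set \<Rightarrow> 'p mod_ring vec set" where
  "Fp2_span r s \<Delta> W = LinearCombinations.module.span (Fp2 \<Delta>) (Fp2_module r s \<Delta>) W"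

definition Fp_dim :: "nat \<Rightarrow> 'p::prime_card mod_ring vec set \<Rightarrow> nat" where
  "Fp_dim n U = vectorspace.dim (class_ring :: 'p mod_ring ring)
     ((module_vec TYPE('p mod_ring) n)\<lparr>carrier := U\<rparr>)"

lemma E_mat_carrier: "E_mat r s \<in> carrier_mat (r + s) (r + s)"
  unfolding E_mat_def by simp

lemma E_mat_index:
  "i < r + s \<Longrightarrow> j < r + s \<Longrightarrow>
   E_mat r s $$ (i, j) = (if i = j then (if i < r then 1 else - 1) else 0)"
  unfolding E_mat_def by (auto simp: four_block_mat_def Let_def)

lemma E_mat_dim [simp]: "dim_row (E_mat r s) = r + s" "dim_col (E_mat r s) = r + s"
  unfolding E_mat_def by simp_all

lemma sqrt_act_carrier: "sqrt_act r s \<Delta> v \<in> carrier_vec (2 * (r + s))"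
proof (rule carrier_vecI)
  show "dim_vec (sqrt_act r s \<Delta> v) = 2 * (r + s)"
    unfolding sqrt_act_def Let_def by simp
qed

lemma transpose_E_mat_mult_vec_index:
  fixes v :: "'a::comm_ring_1 vec"
  assumes "i < r + s" "v \<in> carrier_vec (r + s)"
  shows "(transpose_mat (E_mat r s) *\<^sub>v v) $ i = (if i < r then 1 else - 1) * v $ i"
proof -
  have "(transpose_mat (E_mat r s) *\<^sub>v v) $ i
      = (\<Sum>j = 0..<r + s. E_mat r s $$ (j, i) * v $ j)"
    using assms E_mat_carrier[where ?'a='a, of r s] by (auto simp: scalar_prod_def)
  also have "\<dots> = (\<Sum>j = 0..<r + s. if j = i then (if i < r then 1 else - 1) * v $ i else 0)"
    using assms by (intro sum.cong) (auto simp: E_mat_index)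
  finally show ?thesis using assms by simp
qed

lemma sqrt_act_index:
  assumes "v \<in> carrier_vec (2 * (r + s))" "i < r + s"
  shows "sqrt_act r s \<Delta> v $ i = - of_int \<Delta> * ((if i < r then 1 else - 1) * v $ (r + s + i))"
    and "sqrt_act r s \<Delta> v $ (r + s + i) = (if i < r then 1 else - 1) * v $ i"
proof -
  have "sqrt_act r s \<Delta> v $ i =
      - of_int \<Delta> * (transpose_mat (E_mat r s) *\<^sub>v vec_last v (r + s)) $ i"
    unfolding sqrt_act_def Let_def using assms by (subst index_append_vec) auto
  also have "\<dots> = - of_int \<Delta> * ((if i < r then 1 else - 1) * vec_last v (r + s) $ i)"
    using assms by (subst transpose_E_mat_mult_vec_index) auto
  also have "vec_last v (r + s) $ i = v $ (r + s + i)"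
    using assms unfolding vec_last_def by (simp add: ac_simps)
  finally show "sqrt_act r s \<Delta> v $ i =
      - of_int \<Delta> * ((if i < r then 1 else - 1) * v $ (r + s + i))" .
next
  have "sqrt_act r s \<Delta> v $ (r + s + i) =
      (transpose_mat (E_mat r s) *\<^sub>v vec_first v (r + s)) $ i"
    unfolding sqrt_act_def Let_def using assms by (subst index_append_vec) auto
  also have "\<dots> = (if i < r then 1 else - 1) * vec_first v (r + s) $ i"
    using assms by (subst transpose_E_mat_mult_vec_index) auto
  also have "vec_first v (r + s) $ i = v $ i"
    using assms unfolding vec_first_def by simp
  finally show "sqrt_act r s \<Delta> v $ (r + s + i) = (if i < r then 1 else - 1) * v $ i" .
qed

lemma eq_halvesI:
  assumes "v \<in> carrier_vec (2 * g)" "w \<in> carrier_vec (2 * g)"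
    and "\<And>i. i < g \<Longrightarrow> v $ i = w $ i"
    and "\<And>i. i < g \<Longrightarrow> v $ (g + i) = w $ (g + i)"
  shows "v = w"
proof (rule eq_vecI)
  fix j assume "j < dim_vec w"
  then have j: "j < 2 * g" using assms(2) by auto
  show "v $ j = w $ j"
  proof (cases "j < g")
    case False
    then have "j = g + (j - g)" "j - g < g" using j by auto
    then show ?thesis using assms(4) by metis
  qed (use assms(3) in auto)
qed (use assms(1,2) in auto)

lemma sqrt_act_add:
  assumes v: "v \<in> carrier_vec (2 * (r + s))" and w: "w \<in> carrier_vec (2 * (r + s))"
  shows "sqrt_act r s \<Delta> (v + w) = sqrt_act r s \<Delta> v + sqrt_act r s \<Delta> w"
proof (rule eq_halvesI[of _ "r + s"])
  note J = sqrt_act_carrier[of r s \<Delta> v] sqrt_act_carrier[of r s \<Delta> w]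
  show "sqrt_act r s \<Delta> (v + w) \<in> carrier_vec (2 * (r + s))" by (rule sqrt_act_carrier)
  show "sqrt_act r s \<Delta> v + sqrt_act r s \<Delta> w \<in> carrier_vec (2 * (r + s))"
    using J by (rule add_carrier_vec)
  have d: "dim_vec w = 2 * (r + s)" "dim_vec (sqrt_act r s \<Delta> w) = 2 * (r + s)"
    using w J by auto
  fix i assume i: "i < r + s"
  then have i2: "i < 2 * (r + s)" "r + s + i < 2 * (r + s)" by auto
  note ix = sqrt_act_index[OF v i] sqrt_act_index[OF w i]
    sqrt_act_index[OF add_carrier_vec[OF v w] i]
  show "sqrt_act r s \<Delta> (v + w) $ i = (sqrt_act r s \<Delta> v + sqrt_act r s \<Delta> w) $ i"
    using i2 unfolding ix index_add_vec(1)[of _ w, unfolded d, OF i2(1)]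
      index_add_vec(1)[of _ w, unfolded d, OF i2(2)]
      index_add_vec(1)[of _ "sqrt_act r s \<Delta> w", unfolded d, OF i2(1)]
    by (simp only: ix distrib_left)
  show "sqrt_act r s \<Delta> (v + w) $ (r + s + i) = (sqrt_act r s \<Delta> v + sqrt_act r s \<Delta> w) $ (r + s + i)"
    unfolding ix index_add_vec(1)[of _ w, unfolded d, OF i2(1)]
      index_add_vec(1)[of _ "sqrt_act r s \<Delta> w", unfolded d, OF i2(2)]
    by (simp only: ix distrib_left)
qed

lemma sqrt_act_smult:
  assumes v: "v \<in> carrier_vec (2 * (r + s))"
  shows "sqrt_act r s \<Delta> (c \<cdot>\<^sub>v v) = c \<cdot>\<^sub>v sqrt_act r s \<Delta> v"
proof (rule eq_halvesI[of _ "r + s"])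
  note J = sqrt_act_carrier[of r s \<Delta> v]
  show "sqrt_act r s \<Delta> (c \<cdot>\<^sub>v v) \<in> carrier_vec (2 * (r + s))" by (rule sqrt_act_carrier)
  show "c \<cdot>\<^sub>v sqrt_act r s \<Delta> v \<in> carrier_vec (2 * (r + s))"
    using J by (rule smult_carrier_vec[THEN iffD2])
  have d: "dim_vec v = 2 * (r + s)" "dim_vec (sqrt_act r s \<Delta> v) = 2 * (r + s)"
    using v J by auto
  fix i assume i: "i < r + s"
  then have i2: "i < 2 * (r + s)" "r + s + i < 2 * (r + s)" by auto
  note ix = sqrt_act_index[OF v i] sqrt_act_index[OF smult_carrier_vec[THEN iffD2, OF v] i]
  note sx = index_smult_vec(1)[of _ v, unfolded d, OF i2(1)]
    index_smult_vec(1)[of _ v, unfolded d, OF i2(2)]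
    index_smult_vec(1)[of _ "sqrt_act r s \<Delta> v", unfolded d, OF i2(1)]
    index_smult_vec(1)[of _ "sqrt_act r s \<Delta> v", unfolded d, OF i2(2)]
  show "sqrt_act r s \<Delta> (c \<cdot>\<^sub>v v) $ i = (c \<cdot>\<^sub>v sqrt_act r s \<Delta> v) $ i"
    unfolding ix sx by (simp only: mult_ac)
  show "sqrt_act r s \<Delta> (c \<cdot>\<^sub>v v) $ (r + s + i) = (c \<cdot>\<^sub>v sqrt_act r s \<Delta> v) $ (r + s + i)"
    unfolding ix sx by (simp only: mult_ac)
qed

lemma sqrt_act_square:
  assumes v: "v \<in> carrier_vec (2 * (r + s))"
  shows "sqrt_act r s \<Delta> (sqrt_act r s \<Delta> v) = - of_int \<Delta> \<cdot>\<^sub>v v"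
proof (rule eq_halvesI[of _ "r + s"])
  show "sqrt_act r s \<Delta> (sqrt_act r s \<Delta> v) \<in> carrier_vec (2 * (r + s))" by (rule sqrt_act_carrier)
  show "- of_int \<Delta> \<cdot>\<^sub>v v \<in> carrier_vec (2 * (r + s))" using v by simp
  have d: "dim_vec v = 2 * (r + s)" using v by auto
  fix i assume i: "i < r + s"
  then have i2: "i < 2 * (r + s)" "r + s + i < 2 * (r + s)" by auto
  note ix = sqrt_act_index[OF v i] sqrt_act_index[OF sqrt_act_carrier i]
  note sx = index_smult_vec(1)[of _ v, unfolded d, OF i2(1)]
    index_smult_vec(1)[of _ v, unfolded d, OF i2(2)]
  show "sqrt_act r s \<Delta> (sqrt_act r s \<Delta> v) $ i = (- of_int \<Delta> \<cdot>\<^sub>v v) $ i"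
    unfolding ix sx by (simp split: if_split)
  show "sqrt_act r s \<Delta> (sqrt_act r s \<Delta> v) $ (r + s + i) = (- of_int \<Delta> \<cdot>\<^sub>v v) $ (r + s + i)"
    unfolding ix sx by (simp split: if_split)
qed

lemma Fp2_simps:
  "carrier (Fp2 \<Delta>) = UNIV"
  "monoid.mult (Fp2 \<Delta>) = (\<lambda>(a, b) (c, d). (a * c - of_int \<Delta> * b * d, a * d + b * c))"
  "one (Fp2 \<Delta>) = (1, 0)"
  "zero (Fp2 \<Delta>) = (0, 0)"
  "add (Fp2 \<Delta>) = (\<lambda>(a, b) (c, d). (a + c, b + d))"
  by (simp_all add: Fp2_def)

lemma Fp2_cring: "cring (Fp2 \<Delta> :: ('p::prime_card mod_ring \<times> 'p mod_ring) ring)"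
proof -
  have "\<exists>y. add (Fp2 \<Delta>) y x = zero (Fp2 \<Delta>) \<and> add (Fp2 \<Delta>) x y = zero (Fp2 \<Delta>)"
    for x :: "'p mod_ring \<times> 'p mod_ring"
    by (rule exI[of _ "(- fst x, - snd x)"]) (simp add: Fp2_simps split: prod.splits)
  then show ?thesis
    by unfold_locales
      (auto simp: Fp2_simps Units_def algebra_simps split: prod.splits)
qed

lemma Fp2_module_simps:
  "carrier (Fp2_module r s \<Delta>) = carrier_vec (2 * (r + s))"
  "zero (Fp2_module r s \<Delta>) = 0\<^sub>v (2 * (r + s))"
  "add (Fp2_module r s \<Delta>) = (+)"
  "module.smult (Fp2_module r s \<Delta>) = (\<lambda>(a, b) v. a \<cdot>\<^sub>v v + b \<cdot>\<^sub>v sqrt_act r s \<Delta> v)"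
  by (simp_all add: Fp2_module_def)

lemma Fp2_module_module:
  "Module.module (Fp2 \<Delta>)
     (Fp2_module r s \<Delta> :: ('p::prime_card mod_ring \<times> 'p mod_ring, 'p mod_ring vec) module)"
proof (rule Module.moduleI)
  show "cring (Fp2 \<Delta> :: ('p mod_ring \<times> 'p mod_ring) ring)" by (rule Fp2_cring)
  show "abelian_group (Fp2_module r s \<Delta> :: ('p mod_ring \<times> 'p mod_ring, 'p mod_ring vec) module)"
  proof (rule abelian_groupI)
    fix v :: "'p mod_ring vec"
    assume "v \<in> carrier (Fp2_module r s \<Delta>)"
    then show "\<exists>w\<in>carrier (Fp2_module r s \<Delta>). w \<oplus>\<^bsub>Fp2_module r s \<Delta>\<^esub> v = \<zero>\<^bsub>Fp2_module r s \<Delta>\<^esub>"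
      by (intro bexI[of _ "- v"]) (auto simp: Fp2_module_simps)
  qed (auto simp: Fp2_module_simps intro!: comm_add_vec assoc_add_vec)
next
  let ?n = "2 * (r + s)"
  have J: "sqrt_act r s \<Delta> u \<in> carrier_vec ?n" for u :: "'p mod_ring vec"
    by (rule sqrt_act_carrier)
  have Jd: "dim_vec (sqrt_act r s \<Delta> u) = ?n" for u :: "'p mod_ring vec"
    using J[of u] by auto
  have sc: "c \<cdot>\<^sub>v u \<in> carrier_vec ?n" if "u \<in> carrier_vec ?n" for c and u :: "'p mod_ring vec"
    using that by simp
  fix x y :: "'p mod_ring \<times> 'p mod_ring" and v w :: "'p mod_ring vec"
  obtain a b c d where x: "x = (a, b)" and y: "y = (c, d)" by (metis surj_pair)
  {
    assume "v \<in> carrier (Fp2_module r s \<Delta>)"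
    then have v: "v \<in> carrier_vec ?n" by (simp only: Fp2_module_simps)
    then have vd: "dim_vec v = ?n" by auto
    show "x \<odot>\<^bsub>Fp2_module r s \<Delta>\<^esub> v \<in> carrier (Fp2_module r s \<Delta>)"
      using v J[of v] unfolding x Fp2_module_simps by simp
    show "(x \<oplus>\<^bsub>Fp2 \<Delta>\<^esub> y) \<odot>\<^bsub>Fp2_module r s \<Delta>\<^esub> v =
        x \<odot>\<^bsub>Fp2_module r s \<Delta>\<^esub> v \<oplus>\<^bsub>Fp2_module r s \<Delta>\<^esub> y \<odot>\<^bsub>Fp2_module r s \<Delta>\<^esub> v"
      unfolding x y Fp2_module_simps Fp2_simps
      by (rule eq_vecI) (simp_all add: vd Jd ring_distribs)
    show "\<one>\<^bsub>Fp2 \<Delta>\<^esub> \<odot>\<^bsub>Fp2_module r s \<Delta>\<^esub> v = v"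
      unfolding Fp2_module_simps Fp2_simps by (rule eq_vecI) (simp_all add: vd Jd)
    have "sqrt_act r s \<Delta> (c \<cdot>\<^sub>v v + d \<cdot>\<^sub>v sqrt_act r s \<Delta> v)
        = c \<cdot>\<^sub>v sqrt_act r s \<Delta> v + d \<cdot>\<^sub>v (- of_int \<Delta> \<cdot>\<^sub>v v)"
      by (simp only: sqrt_act_add[OF sc[OF v] sc[OF J]] sqrt_act_smult[OF v] sqrt_act_smult[OF J]
          sqrt_act_square[OF v])
    then show "(x \<otimes>\<^bsub>Fp2 \<Delta>\<^esub> y) \<odot>\<^bsub>Fp2_module r s \<Delta>\<^esub> v =
        x \<odot>\<^bsub>Fp2_module r s \<Delta>\<^esub> (y \<odot>\<^bsub>Fp2_module r s \<Delta>\<^esub> v)"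
      unfolding x y Fp2_module_simps Fp2_simps split
      by (intro eq_vecI) (simp_all add: vd Jd ring_distribs mult_ac)
    assume "w \<in> carrier (Fp2_module r s \<Delta>)"
    then have w: "w \<in> carrier_vec ?n" by (simp only: Fp2_module_simps)
    then have wd: "dim_vec w = ?n" by auto
    show "x \<odot>\<^bsub>Fp2_module r s \<Delta>\<^esub> (v \<oplus>\<^bsub>Fp2_module r s \<Delta>\<^esub> w) =
        x \<odot>\<^bsub>Fp2_module r s \<Delta>\<^esub> v \<oplus>\<^bsub>Fp2_module r s \<Delta>\<^esub> x \<odot>\<^bsub>Fp2_module r s \<Delta>\<^esub> w"
      unfolding x Fp2_module_simps split sqrt_act_add[OF v w]
      by (rule eq_vecI) (simp_all add: vd wd Jd ring_distribs)
  }
qed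

lemma sqrt_neg_square: "\<Delta> \<ge> 0 \<Longrightarrow> sqrt_neg \<Delta> * sqrt_neg \<Delta> = - of_int \<Delta>"
proof -
  assume "\<Delta> \<ge> 0"
  then have "(of_real (sqrt (of_int \<Delta>)) :: complex) * of_real (sqrt (of_int \<Delta>)) = of_int \<Delta>"
    unfolding of_real_mult [symmetric] by simp
  then show ?thesis
    unfolding sqrt_neg_def by (simp add: algebra_simps)
qed

lemma ring_of_integers_simps:
  "carrier (ring_of_integers \<Delta>) = {z \<in> imag_quad_field \<Delta>. algebraic_int z}"
  "monoid.mult (ring_of_integers \<Delta>) = (*)"
  "one (ring_of_integers \<Delta>) = 1"
  "zero (ring_of_integers \<Delta>) = 0"
  "add (ring_of_integers \<Delta>) = (+)"
  by (simp_all add: ring_of_integers_def)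

lemma int_lattice_in_ring_of_integers:
  assumes "\<Delta> \<ge> 0"
  shows "of_int m + of_int n * sqrt_neg \<Delta> \<in> carrier (ring_of_integers \<Delta>)"
proof -
  let ?z = "of_int m + of_int n * sqrt_neg \<Delta>"
  have "?z \<in> imag_quad_field \<Delta>"
    unfolding imag_quad_field_def
    by (rule CollectI, rule exI[of _ "of_int m"], rule exI[of _ "of_int n"]) simp
  moreover have "algebraic_int ?z"
  proof (rule algebraic_int.intros[of "[:of_int (m^2 + n^2 * \<Delta>), of_int (- 2 * m), 1:]"])
    show "\<forall>i. poly.coeff [:of_int (m^2 + n^2 * \<Delta>), of_int (- 2 * m), 1 :: complex:] i \<in> \<int>"
      by (auto simp: coeff_pCons split: nat.split)
    have "poly [:of_int (m^2 + n^2 * \<Delta>), of_int (- 2 * m), 1:] ?z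
        = of_int n ^ 2 * (of_int \<Delta> + sqrt_neg \<Delta> * sqrt_neg \<Delta>)"
      by (simp add: algebra_simps power2_eq_square)
    then show "poly [:of_int (m^2 + n^2 * \<Delta>), of_int (- 2 * m), 1:] ?z = 0"
      using sqrt_neg_square[OF assms] by simp
  qed simp
  ultimately show ?thesis by (simp add: ring_of_integers_simps)
qed

lemma inert_imp_not_square:
  assumes "inert p \<Delta>" "prime p" "odd p" "\<Delta> > 0" "squarefree \<Delta>"
  shows "\<not> int p dvd c\<^sup>2 + \<Delta>"
proof
  assume "int p dvd c\<^sup>2 + \<Delta>"
  then obtain k where k: "c\<^sup>2 + \<Delta> = int p * k" by blast
  let ?O = "ring_of_integers \<Delta>" and ?d = "sqrt_neg \<Delta>"
  let ?I = "PIdl\<^bsub>?O\<^esub> of_nat p"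
  have sq: "?d * ?d = - of_int \<Delta>" using assms(4) by (simp add: sqrt_neg_square)
  interpret primeideal ?I ?O using assms(1) by (simp add: inert_def)
  note lat = int_lattice_in_ring_of_integers[OF less_imp_le[OF assms(4)]]
  note S = ring_of_integers_simps
  have I: "z \<in> ?I \<longleftrightarrow> (\<exists>w \<in> carrier ?O. z = w * of_nat p)" for z
    unfolding cgenideal_def by (auto simp: S)
  define x y where "x = of_int c + ?d" and "y = of_int c - ?d"
  have x: "x \<in> carrier ?O" and y: "y \<in> carrier ?O"
    using lat[of c 1] lat[of c "- 1"] by (simp_all add: x_def y_def)
  have "x * y = of_int (c\<^sup>2 + \<Delta>)"
    using sq by (simp add: x_def y_def algebra_simps power2_eq_square)
  then have "x * y = of_int k * of_nat p" unfolding k by simp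
  moreover have "of_int k \<in> carrier ?O" using lat[of k 0] by simp
  ultimately have "x * y \<in> ?I" using I by blast
  then have "x \<in> ?I \<or> y \<in> ?I" using I_prime[OF x y] by (simp add: S)
  then obtain w \<epsilon> where w: "w \<in> carrier ?O" and \<epsilon>: "\<epsilon> = 1 \<or> \<epsilon> = (- 1 :: int)"
    and eq: "of_int c + of_int \<epsilon> * ?d = w * of_nat p"
  proof (elim disjE)
    assume "x \<in> ?I"
    then show thesis using I[of x] that[of _ 1] by (auto simp: x_def)
  next
    assume "y \<in> ?I"
    then show thesis using I[of y] that[of _ "- 1"] by (auto simp: y_def)
  qed
  have p0: "p \<noteq> 0" using assms(2) by auto
  have alg: "algebraic_int w" using w by (simp add: S)
  then obtain q where q: "lead_coeff q = 1" "\<forall>i. poly.coeff q i \<in> \<int>" "poly q w = 0"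
    by (auto elim: algebraic_int.cases)
  have cw: "cnj w * of_nat p = of_int c - of_int \<epsilon> * ?d"
  proof -
    have "cnj (of_int c + of_int \<epsilon> * ?d) = of_int c - of_int \<epsilon> * ?d"
      by (simp add: sqrt_neg_def)
    then show ?thesis unfolding eq by simp
  qed
  have cO: "cnj w \<in> carrier ?O"
  proof -
    have "cnj (poly.coeff q i) = poly.coeff q i" for i
      using q(2) by (metis Ints_cases complex_cnj_of_int)
    then have "poly q (cnj w) = cnj (poly q w)"
      by (simp add: poly_altdef)
    then have "algebraic_int (cnj w)" using q by (intro algebraic_int.intros[of q]) auto
    moreover have "cnj w \<in> imag_quad_field \<Delta>"
    proof -
      have "cnj w = of_rat (of_int c / of_nat p) + of_rat (of_int (- \<epsilon>) / of_nat p) * ?d"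
      proof -
        have r: "of_rat (of_int m / of_nat p) = (of_int m / of_nat p :: complex)" for m
          by (simp add: of_rat_divide)
        show ?thesis using cw p0 unfolding r by (simp add: field_simps)
      qed
      then show ?thesis unfolding imag_quad_field_def by blast
    qed
    ultimately show ?thesis by (simp add: S)
  qed
  have "- cnj w \<in> carrier ?O"
  proof -
    have "- 1 \<in> carrier ?O" using lat[of "- 1" 0] by simp
    from m_closed[OF this cO] show ?thesis by (simp add: S)
  qed
  from a_closed[OF w this] have u: "w - cnj w \<in> carrier ?O" by (simp add: S)
  define u where "u = w - cnj w"
  have up: "u * of_nat p = of_int (2 * \<epsilon>) * ?d"
    unfolding u_def left_diff_distrib cw eq [symmetric] by simp
  have "u * u \<in> carrier ?O" using m_closed[OF u u] by (simp add: S u_def)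
  then have uu: "algebraic_int (u * u)" by (simp add: S)
  have "(u * u) * of_nat p ^ 2 = (u * of_nat p) * (u * of_nat p)"
    by (simp add: power2_eq_square)
  also have "\<dots> = of_int (2 * \<epsilon>) ^ 2 * (?d * ?d)"
    unfolding up by (simp add: power2_eq_square)
  also have "\<dots> = of_int (- 4 * \<Delta>)" using \<epsilon> sq by auto
  finally have e: "(u * u) * of_nat p ^ 2 = of_int (- 4 * \<Delta>)" .
  have "u * u = of_int (- 4 * \<Delta>) / of_nat p ^ 2"
    unfolding e [symmetric] using p0 by simp
  also have "\<dots> \<in> \<rat>" by (intro Rats_divide Rats_power Rats_of_int Rats_of_nat)
  finally have "u * u \<in> \<rat>" .
  with uu have "u * u \<in> \<int>" by (rule rational_algebraic_int_is_int)
  then obtain j where "u * u = of_int j" by (auto elim: Ints_cases)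
  with e have "(of_int (j * int p ^ 2) :: complex) = of_int (- 4 * \<Delta>)" by simp
  then have "j * int p ^ 2 = - 4 * \<Delta>" unfolding of_int_eq_iff .
  then have "int p ^ 2 dvd 4 * \<Delta>"
    by (metis dvd_minus_iff dvd_triv_right mult_minus_left)
  moreover have "coprime (int p ^ 2) 4"
  proof -
    have "coprime (int p) 2" using assms(3) by simp
    then have "coprime (int p ^ 2) (2 * 2)"
      using coprime_mult_right_iff coprime_power_left_iff by metis
    then show ?thesis by (simp only: mult_2 numeral_plus_numeral add_num_simps)
  qed
  ultimately have "int p ^ 2 dvd \<Delta>" by (simp add: coprime_dvd_mult_right_iff)
  then have "int p dvd 1" using assms(5) unfolding squarefree_def by blast
  then show False using assms(2) by (simp add: prime_nat_iff)
qed

lemma Fp2_field: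
  assumes "inert (CARD('p::prime_card)) \<Delta>" "odd (CARD('p))" "\<Delta> > 0" "squarefree \<Delta>"
  shows "field (Fp2 \<Delta> :: ('p mod_ring \<times> 'p mod_ring) ring)"
proof -
  interpret cring "Fp2 \<Delta> :: ('p mod_ring \<times> 'p mod_ring) ring" by (rule Fp2_cring)
  have nosq: "x\<^sup>2 + of_int \<Delta> \<noteq> 0" for x :: "'p mod_ring"
  proof
    assume *: "x\<^sup>2 + of_int \<Delta> = 0"
    have "(of_int (to_int_mod_ring x) :: 'p mod_ring) = x"
      by (simp add: of_int_of_int_mod_ring)
    with * have "(of_int ((to_int_mod_ring x)\<^sup>2 + \<Delta>) :: 'p mod_ring) = 0" by simp
    then have "((to_int_mod_ring x)\<^sup>2 + \<Delta>) mod int (CARD('p)) = 0"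
      by transfer simp
    then show False
      using inert_imp_not_square[OF assms(1) prime_card assms(2-4)] by auto
  qed
  show ?thesis
  proof (rule cring_fieldI2)
    show "\<zero>\<^bsub>Fp2 \<Delta>\<^esub> \<noteq> (\<one>\<^bsub>Fp2 \<Delta>\<^esub> :: 'p mod_ring \<times> 'p mod_ring)" by (simp add: Fp2_simps)
    fix z :: "'p mod_ring \<times> 'p mod_ring"
    assume "z \<noteq> \<zero>\<^bsub>Fp2 \<Delta>\<^esub>"
    obtain a b where z: "z = (a, b)" by force
    define N where "N = a\<^sup>2 + of_int \<Delta> * b\<^sup>2"
    have N: "N \<noteq> 0"
    proof (cases "b = 0")
      case True
      then show ?thesis using \<open>z \<noteq> _\<close> by (simp add: N_def z Fp2_simps)
    next
      case False
      then have "N = b\<^sup>2 * ((a / b)\<^sup>2 + of_int \<Delta>)"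
        by (simp add: N_def power_divide algebra_simps)
      then show ?thesis using False nosq by simp
    qed
    have "a * (a / N) - of_int \<Delta> * b * (- b / N) = N / N"
      unfolding add_divide_distrib N_def
      by (simp add: power2_eq_square algebra_simps add_divide_distrib)
    then have "z \<otimes>\<^bsub>Fp2 \<Delta>\<^esub> (a / N, - b / N) = \<one>\<^bsub>Fp2 \<Delta>\<^esub>"
      using N by (simp add: z Fp2_simps)
    then show "\<exists>w\<in>carrier (Fp2 \<Delta>). z \<otimes>\<^bsub>Fp2 \<Delta>\<^esub> w = \<one>\<^bsub>Fp2 \<Delta>\<^esub>"
      by (auto simp: Fp2_simps(1))
  qed
qed

end

theory Submission
  imports Defs "Jordan_Normal_Form.Matrix_Kernel"
begin

text \<open>
  Write \<open>S\<close> for the symmetric matrix \<open>s\<close> modulo \<open>p\<close> and \<open>J\<close> for the action of \<open>\<surd>-\<Delta>\<close>. The space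
  \<open>W\<^sub>\<sigma>\<close> is the graph \<open>{(x, S x)}\<close> of \<open>S\<close>, and since \<open>J\<^sup>2 = -\<Delta>\<close> its span over the field with
  \<open>p\<^sup>2\<close> elements is \<open>W + J W\<close>. Its elements are
  \<open>(x, S x) + J (y, S y) = (x - \<Delta> E S y, S x + E y)\<close>.
  Substituting \<open>x' = x - \<Delta> E S y\<close> turns the second component into
  \<open>S x' + (E + \<Delta> S E S) y = S x' + T y\<close>. As \<open>x'\<close> and \<open>y\<close> range freely, the span is the column
  space of the block matrix with rows \<open>(1, 0)\<close> and \<open>(S, T)\<close>. Block elimination of \<open>S\<close> leaves the
  diagonal blocks \<open>1\<close> and \<open>T\<close>, so the dimension is \<open>g + rank T\<close>.

  The span is computed in \<open>Fp2_span_subspace\<close> and \<open>Fp2_span_graph\<close>, the rank of the block matrix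
  in \<open>rank_four_block_one_zero\<close>.
\<close>

section \<open>Rank of a block triangular matrix\<close>

lemma rank_plus_kernel_dim:
  fixes A :: "'a::field mat"
  assumes A: "A \<in> carrier_mat nr nc"
  shows "vec_space.rank nr A + kernel.dim nc A = nc"
proof -
  interpret W: vec_space "TYPE('a)" nr .
  interpret V: vec_space "TYPE('a)" nc .
  interpret K: kernel nr nc A by (unfold_locales, rule A)
  have hom: "mod_hom class_ring V.V W.V (\<lambda>v. A *\<^sub>v v)"
    using A by (intro mod_hom.intro vec_module mod_hom_axioms.intro)
      (auto simp: LinearCombinations.module_hom_def module_vec_simps mult_add_distrib_mat_vec mult_mat_vec)
  interpret L: linear_map class_ring V.V W.V "\<lambda>v. A *\<^sub>v v"
    by (intro linear_map.intro vec_vs hom)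
  have im: "L.im = W.span (set (cols A))"
    using W.col_space_eq[OF A] A
    unfolding L.im_def W.col_space_def by (auto simp: module_vec_simps)
  have ker: "L.ker = mat_kernel A"
    using A unfolding L.ker_def mat_kernel_def by (auto simp: module_vec_simps)
  show ?thesis
    using L.rank_nullity[OF V.fin_dim] V.dim_is_n
    unfolding im ker W.rank_def by simp
qed

text \<open>
  By rank-nullity it suffices to compare kernels. Eliminating \<open>S\<close> by an invertible row operation
  keeps the kernel and leaves a block diagonal matrix with blocks \<open>1\<close> and \<open>T\<close>, whose kernel has
  the dimension of the kernel of \<open>T\<close>.
\<close>

lemma rank_four_block_one_zero:
  fixes S T :: "'a::field mat"
  assumes S: "S \<in> carrier_mat h g" and T: "T \<in> carrier_mat h h"
  shows "vec_space.rank (g + h) (four_block_mat (1\<^sub>m g) (0\<^sub>m g h) S T)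
    = g + vec_space.rank h T"
proof -
  let ?L = "\<lambda>X. four_block_mat (1\<^sub>m g) (0\<^sub>m g h) X (1\<^sub>m h) :: 'a mat"
  let ?D = "four_block_mat (1\<^sub>m g) (0\<^sub>m g h) (0\<^sub>m h g) T"
  let ?M = "four_block_mat (1\<^sub>m g) (0\<^sub>m g h) S T"
  have one: "(1\<^sub>m n :: 'a mat) \<in> carrier_mat n n" for n by simp
  have zero: "(0\<^sub>m m n :: 'a mat) \<in> carrier_mat m n" for m n by simp
  have minus: "- S \<in> carrier_mat h g" using S by simp
  have M: "?L S * ?D = ?M"
    using S T by (subst mult_four_block_mat[OF one zero S one one zero zero T]) auto
  have inv: "?L (- S) * ?L S = 1\<^sub>m (g + h)"
    using S by (subst mult_four_block_mat[OF one zero minus one one zero S one]) auto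
  have "mat_kernel ?M = mat_kernel ?D"
    unfolding M[symmetric]
    by (rule mat_kernel_mult_eq[OF _ _ _ inv]) (use S T in auto)
  then have "kernel.dim (g + h) ?M = kernel.dim (g + h) ?D" by simp
  also have "\<dots> = kernel.dim h T"
    using kernel_four_block_0_mat[OF refl one T] kernel_one_mat(1)[where ?'a='a, of g] by simp
  finally have "kernel.dim (g + h) ?M = kernel.dim h T" .
  moreover have "vec_space.rank (g + h) ?M + kernel.dim (g + h) ?M = g + h"
    by (rule rank_plus_kernel_dim) (use T in auto)
  moreover have "vec_space.rank h T + kernel.dim h T = h"
    by (rule rank_plus_kernel_dim[OF T])
  ultimately show ?thesis by linarith
qed

section \<open>The isotropic subspace and its span over the quadratic extension\<close>

text \<open>
  The row vector \<open>x S\<close> is the column vector \<open>S\<^sup>T x\<close>. In the application \<open>S\<close> is symmetric, so that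
  this is the graph of \<open>S\<close> itself.
\<close>

lemma W_space_eq_graph:
  fixes g :: nat and \<sigma> :: "int mat"
  defines "S \<equiv> reduce (upper_right g \<sigma>) :: 'p::prime_card mod_ring mat"
  assumes S: "S \<in> carrier_mat g g"
  shows "W_space g \<sigma> = (\<lambda>x. x @\<^sub>v (transpose_mat S *\<^sub>v x)) ` carrier_vec g"
proof -
  let ?A = "four_block_mat (1\<^sub>m g) S (0\<^sub>m 0 g) (0\<^sub>m 0 g)"
  interpret V: vec_space "TYPE('p mod_ring)" "2 * g" .
  have A: "?A \<in> carrier_mat g (2 * g)"
    using four_block_carrier_mat[of "1\<^sub>m g :: 'p mod_ring mat" g g "0\<^sub>m 0 g" 0 g] by (simp add: mult_2)
  have T: "transpose_mat ?A = four_block_mat (1\<^sub>m g) (0\<^sub>m g 0) (transpose_mat S) (0\<^sub>m g 0)"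
    using S by (subst transpose_four_block_mat) auto
  have eq: "transpose_mat ?A *\<^sub>v x = x @\<^sub>v (transpose_mat S *\<^sub>v x)" if x: "x \<in> carrier_vec g" for x
  proof -
    (* The lower blocks of ?A have no rows, so the matching part of the argument is empty. *)
    have "x = x @\<^sub>v vNil" by auto
    then have "transpose_mat ?A *\<^sub>v x = transpose_mat ?A *\<^sub>v (x @\<^sub>v vNil)" by simp
    also have "\<dots> = (1\<^sub>m g *\<^sub>v x + 0\<^sub>m g 0 *\<^sub>v vNil) @\<^sub>v (transpose_mat S *\<^sub>v x + 0\<^sub>m g 0 *\<^sub>v vNil)"
      unfolding T using S x by (intro four_block_mat_mult_vec) auto
    also have "0\<^sub>m g 0 *\<^sub>v vNil = (0\<^sub>v g :: 'p mod_ring vec)" by (rule eq_vecI) auto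
    finally show ?thesis using S x by simp
  qed
  have "x @\<^sub>v (transpose_mat S *\<^sub>v x) \<in> carrier_vec (2 * g)" if "x \<in> carrier_vec g" for x
    using that S unfolding mult_2 by (intro append_carrier_vec) auto
  with eq show ?thesis
    unfolding W_space_def S_def[symmetric] V.row_space_eq[OF A] carrier_matD[OF A] image_def
    by (intro Collect_cong) metis
qed

text \<open>
  The sums \<open>v + J w\<close> are stable under \<open>a + b \<surd>-\<Delta>\<close> because \<open>J\<^sup>2 = -\<Delta>\<close> brings \<open>J (J w)\<close> back
  into \<open>W\<close>; they therefore form the smallest submodule containing \<open>W\<close>.
\<close>

lemma Fp2_span_subspace:
  fixes W :: "'p::prime_card mod_ring vec set"
  assumes sub: "W \<subseteq> carrier_vec (2 * (r + s))" and zero: "0\<^sub>v (2 * (r + s)) \<in> W"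
    and add: "\<And>v w. v \<in> W \<Longrightarrow> w \<in> W \<Longrightarrow> v + w \<in> W"
    and smult: "\<And>c v. v \<in> W \<Longrightarrow> c \<cdot>\<^sub>v v \<in> W"
  shows "Fp2_span r s \<Delta> W = {v + sqrt_act r s \<Delta> w | v w. v \<in> W \<and> w \<in> W}" (is "_ = ?U")
proof
  let ?n = "2 * (r + s)"
  interpret M: Module.module "Fp2 \<Delta>" "Fp2_module r s \<Delta> :: ('p mod_ring \<times> 'p mod_ring, 'p mod_ring vec) module"
    by (rule Fp2_module_module)
  note simps = Fp2_module_simps Fp2_simps
  have subM: "W \<subseteq> carrier (Fp2_module r s \<Delta>)" using sub by (simp add: simps)
  have J: "sqrt_act r s \<Delta> w \<in> carrier_vec ?n" for w :: "'p mod_ring vec" by (rule sqrt_act_carrier)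
  have W: "v \<in> carrier_vec ?n" if "v \<in> W" for v using sub that by blast
  show "?U \<subseteq> Fp2_span r s \<Delta> W"
  proof
    fix u assume "u \<in> ?U"
    then obtain v w where vw: "v \<in> W" "w \<in> W" and u: "u = v + sqrt_act r s \<Delta> w" by auto
    interpret sm: submodule "Fp2 \<Delta>" "M.span W" "Fp2_module r s \<Delta> :: ('p mod_ring \<times> 'p mod_ring, 'p mod_ring vec) module"
      by (rule M.span_is_submodule[OF subM])
    have in_span: "v \<in> M.span W" "w \<in> M.span W" using M.in_own_span[OF subM] vw by auto
    (* The pair (0, 1) is the square root of -\<Delta>. *)
    have "(0, 1) \<odot>\<^bsub>Fp2_module r s \<Delta>\<^esub> w \<in> M.span W"
      using in_span by (intro sm.smult_closed) (simp_all add: simps)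
    moreover have "(0, 1) \<odot>\<^bsub>Fp2_module r s \<Delta>\<^esub> w = sqrt_act r s \<Delta> w"
      using J[of w] W[OF vw(2)] unfolding simps by (intro eq_vecI) auto
    ultimately have "v \<oplus>\<^bsub>Fp2_module r s \<Delta>\<^esub> sqrt_act r s \<Delta> w \<in> M.span W"
      using in_span by (intro sm.m_closed) simp_all
    then show "u \<in> Fp2_span r s \<Delta> W" by (simp add: u simps Fp2_span_def)
  qed
  have lmult_0_vec: "0 \<cdot>\<^sub>v v = 0\<^sub>v ?n" if "v \<in> carrier_vec ?n" for v :: "'p mod_ring vec"
    using that by (intro eq_vecI) auto
  have JJ: "sqrt_act r s \<Delta> (sqrt_act r s \<Delta> w) = - of_int \<Delta> \<cdot>\<^sub>v w" if "w \<in> W" for w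
    using sqrt_act_square[OF W[OF that]] .
  have "submodule (Fp2 \<Delta>) ?U (Fp2_module r s \<Delta> :: ('p mod_ring \<times> 'p mod_ring, 'p mod_ring vec) module)"
  proof (rule submodule.intro)
    show "Module.module (Fp2 \<Delta>) (Fp2_module r s \<Delta> :: ('p mod_ring \<times> 'p mod_ring, 'p mod_ring vec) module)"
      by (rule Fp2_module_module)
    show "?U \<subseteq> carrier (Fp2_module r s \<Delta>)" using W J by (auto simp: simps)
    show "\<zero>\<^bsub>Fp2_module r s \<Delta>\<^esub> \<in> ?U"
    proof -
      have "sqrt_act r s \<Delta> (0\<^sub>v ?n) = (0\<^sub>v ?n :: 'p mod_ring vec)"
        using sqrt_act_smult[of "0\<^sub>v ?n :: 'p mod_ring vec" r s \<Delta> 0] J[of "0\<^sub>v ?n"]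
        by (simp only: lmult_0_vec[OF J] lmult_0_vec[OF zero_carrier_vec] zero_carrier_vec)
      then have "0\<^sub>v ?n = 0\<^sub>v ?n + sqrt_act r s \<Delta> (0\<^sub>v ?n :: 'p mod_ring vec)" by simp
      then show ?thesis using zero unfolding simps by blast
    qed
  next
    fix u u' :: "'p mod_ring vec" assume "u \<in> ?U" "u' \<in> ?U"
    then obtain v w v' w' where vw: "v \<in> W" "w \<in> W" "v' \<in> W" "w' \<in> W"
      and u: "u = v + sqrt_act r s \<Delta> w" "u' = v' + sqrt_act r s \<Delta> w'" by blast
    have "u + u' = (v + v') + sqrt_act r s \<Delta> (w + w')"
      unfolding u sqrt_act_add[OF W[OF vw(2)] W[OF vw(4)]]
      using W[OF vw(1)] W[OF vw(3)] J[of w] J[of w'] by (intro eq_vecI) auto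
    then show "u \<oplus>\<^bsub>Fp2_module r s \<Delta>\<^esub> u' \<in> ?U" using add vw unfolding simps by blast
  next
    fix z :: "'p mod_ring \<times> 'p mod_ring" and u :: "'p mod_ring vec" assume "u \<in> ?U"
    then obtain v w where vw: "v \<in> W" "w \<in> W" and u: "u = v + sqrt_act r s \<Delta> w" by blast
    obtain a b where z: "z = (a, b)" by force
    have sm: "c \<cdot>\<^sub>v x \<in> carrier_vec ?n" if "x \<in> W" for c x using W[OF that] by simp
    have "a \<cdot>\<^sub>v u + b \<cdot>\<^sub>v sqrt_act r s \<Delta> u
        = (a \<cdot>\<^sub>v v + (- b * of_int \<Delta>) \<cdot>\<^sub>v w) + sqrt_act r s \<Delta> (a \<cdot>\<^sub>v w + b \<cdot>\<^sub>v v)"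
      unfolding u sqrt_act_add[OF W[OF vw(1)] J] JJ[OF vw(2)] sqrt_act_add[OF sm[OF vw(2)] sm[OF vw(1)]]
        sqrt_act_smult[OF W[OF vw(1)]] sqrt_act_smult[OF W[OF vw(2)]]
      using W[OF vw(1)] W[OF vw(2)] J[of v] J[of w]
      by (intro eq_vecI) (auto simp: ring_distribs)
    moreover have "a \<cdot>\<^sub>v v + (- b * of_int \<Delta>) \<cdot>\<^sub>v w \<in> W" "a \<cdot>\<^sub>v w + b \<cdot>\<^sub>v v \<in> W"
      using add smult vw by blast+
    ultimately show "z \<odot>\<^bsub>Fp2_module r s \<Delta>\<^esub> u \<in> ?U" unfolding z simps split by blast
  qed
  moreover have "W \<subseteq> ?U"
  proof
    fix v assume v: "v \<in> W"
    have "sqrt_act r s \<Delta> (0 \<cdot>\<^sub>v v) = 0 \<cdot>\<^sub>v sqrt_act r s \<Delta> v"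
      by (rule sqrt_act_smult[OF W[OF v]])
    then have "v = v + sqrt_act r s \<Delta> (0 \<cdot>\<^sub>v v)"
      using W[OF v] J[of v] by (intro eq_vecI) auto
    then show "v \<in> ?U" using v smult by blast
  qed
  ultimately show "Fp2_span r s \<Delta> W \<subseteq> ?U"
    unfolding Fp2_span_def by (intro M.span_is_subset)
qed

text \<open>
  This is where \<open>T = E + \<Delta> S E S\<close> comes from: the change of variables
  \<open>(x, y) \<mapsto> (x - \<Delta> E S y, y)\<close> is a bijection, and after it the second component of
  \<open>(x, S x) + J (y, S y)\<close> is \<open>S x' + T y\<close>. Symmetry of \<open>E\<close> turns the row action \<open>y E\<close> into \<open>E y\<close>.
\<close>

lemma Fp2_span_graph:
  fixes r s g :: nat and \<Delta> :: int and S :: "'p::prime_card mod_ring mat"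
  defines "E \<equiv> E_mat r s :: 'p mod_ring mat"
  defines "T \<equiv> E + of_int \<Delta> \<cdot>\<^sub>m (S * E * S)"
  defines "M \<equiv> four_block_mat (1\<^sub>m g) (0\<^sub>m g g) S T"
  assumes g: "r + s = g" and S: "S \<in> carrier_mat g g"
  shows "Fp2_span r s \<Delta> ((\<lambda>x. x @\<^sub>v (S *\<^sub>v x)) ` carrier_vec g)
    = (\<lambda>v. M *\<^sub>v v) ` carrier_vec (2 * g)" (is "Fp2_span r s \<Delta> ?W = _")
proof -
  have E: "E \<in> carrier_mat g g" unfolding E_def g[symmetric] by (rule E_mat_carrier)
  have Et: "transpose_mat E = E"
    unfolding E_def by (rule eq_matI) (auto simp: E_mat_index)
  have T: "T \<in> carrier_mat g g" using S E unfolding T_def by simp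
  have W: "?W \<subseteq> carrier_vec (2 * g)" using S by (auto simp: mult_2)
  have span: "Fp2_span r s \<Delta> ?W = {v + sqrt_act r s \<Delta> w | v w. v \<in> ?W \<and> w \<in> ?W}"
  proof (rule Fp2_span_subspace[of _ r s, unfolded g])
    show "?W \<subseteq> carrier_vec (2 * g)" by (rule W)
    have "(0\<^sub>v g :: 'p mod_ring vec) @\<^sub>v (S *\<^sub>v 0\<^sub>v g) = 0\<^sub>v (2 * g)"
      using S by (intro eq_vecI) auto
    then show "0\<^sub>v (2 * g) \<in> ?W" by (intro image_eqI[of _ _ "0\<^sub>v g"]) simp_all
  next
    fix v w assume v: "v \<in> ?W" and w: "w \<in> ?W"
    obtain x where x: "v = x @\<^sub>v (S *\<^sub>v x)" "x \<in> carrier_vec g" using v by (rule imageE)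
    obtain y where y: "w = y @\<^sub>v (S *\<^sub>v y)" "y \<in> carrier_vec g" using w by (rule imageE)
    have "v + w = (x + y) @\<^sub>v (S *\<^sub>v (x + y))"
      unfolding x y using x y S
      by (simp add: mult_add_distrib_mat_vec append_vec_add[of _ g _ _ g])
    with x y show "v + w \<in> ?W" by (intro image_eqI[of _ _ "x + y"]) simp_all
  next
    fix c v assume v: "v \<in> ?W"
    obtain x where x: "v = x @\<^sub>v (S *\<^sub>v x)" "x \<in> carrier_vec g" using v by (rule imageE)
    have "c \<cdot>\<^sub>v v = (c \<cdot>\<^sub>v x) @\<^sub>v (S *\<^sub>v (c \<cdot>\<^sub>v x))"
      unfolding x mult_mat_vec[OF S x(2)] by (intro eq_vecI) auto
    with x show "c \<cdot>\<^sub>v v \<in> ?W" by (intro image_eqI[of _ _ "c \<cdot>\<^sub>v x"]) simp_all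
  qed
  have key: "(x @\<^sub>v (S *\<^sub>v x)) + sqrt_act r s \<Delta> (y @\<^sub>v (S *\<^sub>v y))
      = M *\<^sub>v ((x - of_int \<Delta> \<cdot>\<^sub>v (E *\<^sub>v (S *\<^sub>v y))) @\<^sub>v y)"
    if x: "x \<in> carrier_vec g" and y: "y \<in> carrier_vec g" for x y
  proof -
    let ?z = "E *\<^sub>v (S *\<^sub>v y)" and ?d = "of_int \<Delta> :: 'p mod_ring"
    have z: "?z \<in> carrier_vec g" using S E y by simp
    have first: "vec_first (y @\<^sub>v (S *\<^sub>v y)) g = y" and last: "vec_last (y @\<^sub>v (S *\<^sub>v y)) g = S *\<^sub>v y"
      using S y by (auto simp: vec_first_def vec_last_def intro!: eq_vecI)
    have "sqrt_act r s \<Delta> (y @\<^sub>v (S *\<^sub>v y)) = (- ?d \<cdot>\<^sub>v ?z) @\<^sub>v (E *\<^sub>v y)"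
      unfolding sqrt_act_def g E_def[symmetric] Let_def first last Et ..
    then have l: "(x @\<^sub>v (S *\<^sub>v x)) + sqrt_act r s \<Delta> (y @\<^sub>v (S *\<^sub>v y))
        = (x + - ?d \<cdot>\<^sub>v ?z) @\<^sub>v (S *\<^sub>v x + E *\<^sub>v y)"
      using x y z S E by (simp add: append_vec_add[of _ g _ _ g])
    have x': "x - ?d \<cdot>\<^sub>v ?z \<in> carrier_vec g" using x z by simp
    have smult_mat_mult: "(c \<cdot>\<^sub>m A) *\<^sub>v w = c \<cdot>\<^sub>v (A *\<^sub>v w)"
      if "A \<in> carrier_mat g g" "w \<in> carrier_vec g" for c A and w :: "'p mod_ring vec"
      using that by (intro eq_vecI) auto
    have Ty: "T *\<^sub>v y = E *\<^sub>v y + ?d \<cdot>\<^sub>v (S *\<^sub>v ?z)"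
      unfolding T_def using S E y
      by (simp add: add_mult_distrib_mat_vec[of _ g g] smult_mat_mult assoc_mult_mat_vec[of _ g g _ g])
    have Sx: "S *\<^sub>v (x - ?d \<cdot>\<^sub>v ?z) = S *\<^sub>v x - ?d \<cdot>\<^sub>v (S *\<^sub>v ?z)"
      using S x z by (simp add: mult_minus_distrib_mat_vec[of _ g g] mult_mat_vec[of _ g g])
    have "M *\<^sub>v ((x - ?d \<cdot>\<^sub>v ?z) @\<^sub>v y)
        = (1\<^sub>m g *\<^sub>v (x - ?d \<cdot>\<^sub>v ?z) + 0\<^sub>m g g *\<^sub>v y) @\<^sub>v (S *\<^sub>v (x - ?d \<cdot>\<^sub>v ?z) + T *\<^sub>v y)"
      unfolding M_def using S T y x'
      by (intro four_block_mat_mult_vec) auto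
    also have "1\<^sub>m g *\<^sub>v (x - ?d \<cdot>\<^sub>v ?z) + 0\<^sub>m g g *\<^sub>v y = x + - ?d \<cdot>\<^sub>v ?z"
    proof -
      have "0\<^sub>m g g *\<^sub>v y = 0\<^sub>v g" using y by (intro eq_vecI) auto
      then show ?thesis using x z carrier_vecD[OF z]
        by (intro eq_vecI) (simp_all del: index_mult_mat_vec dim_mult_mat_vec)
    qed
    also have "S *\<^sub>v (x - ?d \<cdot>\<^sub>v ?z) + T *\<^sub>v y = S *\<^sub>v x + E *\<^sub>v y"
      unfolding Sx Ty using S E x y z by (intro eq_vecI) auto
    finally show ?thesis using l by simp
  qed
  show ?thesis unfolding span
  proof (intro equalityI subsetI)
    fix u assume "u \<in> {v + sqrt_act r s \<Delta> w | v w. v \<in> ?W \<and> w \<in> ?W}"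
    then obtain v w where u: "u = v + sqrt_act r s \<Delta> w" and v: "v \<in> ?W" and w: "w \<in> ?W"
      by (elim CollectE exE conjE)
    obtain x where vx: "v = x @\<^sub>v (S *\<^sub>v x)" and x: "x \<in> carrier_vec g" using v by (rule imageE)
    obtain y where wy: "w = y @\<^sub>v (S *\<^sub>v y)" and y: "y \<in> carrier_vec g" using w by (rule imageE)
    have "(x - of_int \<Delta> \<cdot>\<^sub>v (E *\<^sub>v (S *\<^sub>v y))) @\<^sub>v y \<in> carrier_vec (2 * g)"
      using x y S E by (simp add: mult_2)
    then show "u \<in> (\<lambda>v. M *\<^sub>v v) ` carrier_vec (2 * g)"
      unfolding u vx wy key[OF x y] by (rule imageI)
  next
    fix u assume "u \<in> (\<lambda>v. M *\<^sub>v v) ` carrier_vec (2 * g)"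
    then obtain v where u: "u = M *\<^sub>v v" and v: "v \<in> carrier_vec (g + g)"
      unfolding mult_2 by (rule imageE)
    define x' y where "x' = vec_first v g" and "y = vec_last v g"
    have x': "x' \<in> carrier_vec g" and y: "y \<in> carrier_vec g" and v': "v = x' @\<^sub>v y"
      using v by (simp_all add: x'_def y_def)
    (* Inverse of the change of variables. *)
    define x where "x = x' + of_int \<Delta> \<cdot>\<^sub>v (E *\<^sub>v (S *\<^sub>v y))"
    have x: "x \<in> carrier_vec g" using x' y S E by (simp add: x_def)
    have "x - of_int \<Delta> \<cdot>\<^sub>v (E *\<^sub>v (S *\<^sub>v y)) = x'"
      unfolding x_def using x' y S E by (intro eq_vecI) auto
    with key[OF x y] have "u = (x @\<^sub>v (S *\<^sub>v x)) + sqrt_act r s \<Delta> (y @\<^sub>v (S *\<^sub>v y))"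
      unfolding u v' by simp
    then show "u \<in> {v + sqrt_act r s \<Delta> w | v w. v \<in> ?W \<and> w \<in> ?W}"
      using imageI[OF x, of "\<lambda>x. x @\<^sub>v (S *\<^sub>v x)"] imageI[OF y, of "\<lambda>x. x @\<^sub>v (S *\<^sub>v x)"]
      by (intro CollectI exI conjI)
  qed
qed

section \<open>Comparison of rank and dimension\<close>

theorem lemma3p2p3:
  fixes p r s g :: nat and \<Delta> :: int and R :: "int set" and \<sigma> :: "int mat"
  assumes "p = CARD('p::prime_card)" and "odd p"
    and "\<Delta> > 0" and "squarefree \<Delta>"
    and "inert p \<Delta>"
    and "g = r + s"
    and "residue_system p R"
    and "\<sigma> \<in> S_open p R g"
  shows "int (vec_space.rank g (reduce (T_mat r s \<Delta> \<sigma>) :: 'p mod_ring mat)) =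
         int (Fp_dim (2 * g) (Fp2_span r s \<Delta> (W_space g \<sigma> :: 'p mod_ring vec set))) - int g"
proof -
  note g = \<open>g = r + s\<close>
  obtain S where S: "S \<in> carrier_mat g g" "transpose_mat S = S"
    and \<sigma>: "\<sigma> = four_block_mat (1\<^sub>m g) S (0\<^sub>m g g) (of_nat p \<cdot>\<^sub>m 1\<^sub>m g)"
    using \<open>\<sigma> \<in> S_open p R g\<close> unfolding S_open_def by blast
  have ur: "upper_right g \<sigma> = S"
    unfolding upper_right_def \<sigma> split_block_def Let_def using S
    by (auto intro!: eq_matI)
  define S' where "S' = (reduce S :: 'p mod_ring mat)"
  have S': "S' \<in> carrier_mat g g" "transpose_mat S' = S'"
    using S by (simp_all add: S'_def map_mat_transpose)
  have E: "reduce (E_mat r s) = (E_mat r s :: 'p mod_ring mat)"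
    by (rule eq_matI) (auto simp: E_mat_index)
  define T where "T = (E_mat r s + of_int \<Delta> \<cdot>\<^sub>m (S' * E_mat r s * S') :: 'p mod_ring mat)"
  have Ec: "(E_mat r s :: int mat) \<in> carrier_mat g g" "(E_mat r s :: 'p mod_ring mat) \<in> carrier_mat g g"
    unfolding g by (rule E_mat_carrier)+
  have redT: "reduce (T_mat r s \<Delta> \<sigma>) = T"
  proof -
    have "reduce (T_mat r s \<Delta> \<sigma>) = reduce (E_mat r s) + reduce (\<Delta> \<cdot>\<^sub>m (S * E_mat r s * S))"
      unfolding T_mat_def Let_def g[symmetric] ur using S Ec
      by (intro eq_matI) auto
    also have "reduce (\<Delta> \<cdot>\<^sub>m (S * E_mat r s * S)) = (of_int \<Delta> \<cdot>\<^sub>m reduce (S * E_mat r s * S) :: 'p mod_ring mat)"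
      by (rule eq_matI) auto
    also have "reduce (S * E_mat r s * S) = S' * E_mat r s * S'"
      using S Ec by (simp add: of_int_hom.mat_hom_mult[of _ g g _ g] E S'_def)
    finally show ?thesis unfolding T_def E .
  qed
  define M where "M = four_block_mat (1\<^sub>m g) (0\<^sub>m g g) S' T"
  have T: "T \<in> carrier_mat g g" using S' Ec unfolding T_def by simp
  have M: "M \<in> carrier_mat (2 * g) (2 * g)" using T unfolding M_def mult_2 by simp
  interpret V: vec_space "TYPE('p mod_ring)" "2 * g" .
  have "(W_space g \<sigma> :: 'p mod_ring vec set) = (\<lambda>x. x @\<^sub>v (S' *\<^sub>v x)) ` carrier_vec g"
    using W_space_eq_graph[of g \<sigma>, where ?'p='p] S' unfolding ur S'_def[symmetric] by simp
  then have "Fp2_span r s \<Delta> (W_space g \<sigma> :: 'p mod_ring vec set) = (\<lambda>v. M *\<^sub>v v) ` carrier_vec (2 * g)"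
    using Fp2_span_graph[OF g[symmetric] S'(1), of \<Delta>] unfolding M_def T_def by simp
  also have "\<dots> = V.col_space M"
    unfolding V.col_space_eq[OF M] using M by auto
  finally have "Fp_dim (2 * g) (Fp2_span r s \<Delta> (W_space g \<sigma> :: 'p mod_ring vec set)) = V.rank M"
    unfolding Fp_dim_def V.rank_def V.col_space_def by simp
  also have "\<dots> = g + vec_space.rank g T"
    using rank_four_block_one_zero[OF S'(1) T] unfolding M_def mult_2 .
  finally show ?thesis unfolding redT by simp
qed

end
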